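(* Let $p$ be a prime, let $\Gamma$ be an infinite finitely generated group, and let $\Delta\triangleleft\Gamma$ be a normal subgroup of index $p$. Then $\mathrm{def}_p(\Delta)\geq p\cdot\mathrm{def}_p(\Gamma)$.
   Context: Let $X$ be a finite set and $F(X)$ the free group over $X$. For $r\in F(X)$, the $p$-order $\nu_p(r)$ is the largest integer $k\ge 0$ such that there is some $s\in F(X)$ with $r=s^{p^k}$ (for $r=1$ put $\nu_p(1)=\infty$ and $p^{-\infty}=0$). For a group presentation $\langle X\mid R\rangle$ with $X$ finite and $R\subseteq F(X)$ (possibly infinite), the $p$-deficiency of the presentation is $|X|-1-\sum_{r\in R}p^{-\nu_p(r)}$ (equal to $-\infty$ if the sum diverges). The $p$-deficiency $\mathrm{def}_p(\Gamma)$ of a finitely generated group $\Gamma$ is the supremum of the $p$-deficiencies of all presentations of $\Gamma$ with finite generating set. *)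

theory Defs
  imports
    "HOL-Algebra.Generated_Groups"
    "HOL-Computational_Algebra.Primes"
    "HOL-Library.Extended_Nat"
    "HOL-Library.Extended_Real"
    "HOL-Analysis.Infinite_Sum"
begin

section \<open>Free groups\<close>

text \<open>
  Elements of the free group on \<open>X\<close> are reduced words over the letters \<open>(x, True)\<close>, standing for
  the generator \<open>x\<close>, and \<open>(x, False)\<close>, standing for its inverse.
\<close>

type_synonym 'a word = "('a \<times> bool) list"

fun inv_letter :: "'a \<times> bool \<Rightarrow> 'a \<times> bool" where
  "inv_letter (x, b) = (x, \<not> b)"

definition reduced :: "'a word \<Rightarrow> bool" where
  "reduced w \<longleftrightarrow> successively (\<lambda>a b. b \<noteq> inv_letter a) w"

definition cons_letter :: "'a \<times> bool \<Rightarrow> 'a word \<Rightarrow> 'a word" where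
  "cons_letter a w = (if w \<noteq> [] \<and> hd w = inv_letter a then tl w else a # w)"

text \<open>
  If \<open>w\<close> is reduced then \<open>cons_letter a w\<close> is the reduced form of \<open>a # w\<close>, so for reduced words
  \<open>u\<close>, \<open>v\<close> the multiplication below yields the reduced form of the concatenation \<open>u @ v\<close>.
\<close>

definition free_group :: "'a set \<Rightarrow> 'a word monoid" where
  "free_group X =
    \<lparr>carrier = {w. set w \<subseteq> X \<times> UNIV \<and> reduced w},
     monoid.mult = (\<lambda>u v. foldr cons_letter u v),
     one = []\<rparr>"

lemma inv_letter_inv_letter [simp]: "inv_letter (inv_letter a) = a"
  by (cases a) simp

lemma inv_letter_neq [simp]: "inv_letter a \<noteq> a"
  by (cases a) simp

lemma fst_inv_letter [simp]: "fst (inv_letter a) = fst a"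
  by (cases a) simp

lemma reduced_Nil [simp]: "reduced []"
  by (simp add: reduced_def)

lemma reduced_Cons: "reduced (a # w) \<longleftrightarrow> (w = [] \<or> hd w \<noteq> inv_letter a) \<and> reduced w"
  by (cases w) (auto simp: reduced_def)

lemma reduced_cons_letter: "reduced w \<Longrightarrow> reduced (cons_letter a w)"
  by (cases w) (auto simp: cons_letter_def reduced_Cons)

lemma cons_letter_cancel: "reduced w \<Longrightarrow> cons_letter (inv_letter a) (cons_letter a w) = w"
  by (cases w) (auto simp: cons_letter_def reduced_Cons)

lemma reduced_foldr_cons_letter: "reduced v \<Longrightarrow> reduced (foldr cons_letter u v)"
  by (induction u) (auto intro: reduced_cons_letter)

lemma set_cons_letter: "set (cons_letter a w) \<subseteq> insert a (set w)"
  by (cases w) (auto simp: cons_letter_def)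

lemma set_foldr_cons_letter: "set (foldr cons_letter u v) \<subseteq> set u \<union> set v"
  using set_cons_letter by (induction u) fastforce+

lemma foldr_cons_letter_Nil: "reduced u \<Longrightarrow> foldr cons_letter u [] = u"
  by (induction u) (auto simp: cons_letter_def reduced_Cons)

lemma foldr_cons_letter_assoc:
  assumes "reduced w"
  shows "foldr cons_letter (foldr cons_letter u v) w = foldr cons_letter u (foldr cons_letter v w)"
proof (induction u)
  case (Cons a u)
  have "foldr cons_letter (cons_letter a t) w = cons_letter a (foldr cons_letter t w)" for t
  proof (cases "t \<noteq> [] \<and> hd t = inv_letter a")
    case True
    then obtain s where t: "t = inv_letter a # s"
      by (cases t) auto
    have "cons_letter a (cons_letter (inv_letter a) (foldr cons_letter s w)) = foldr cons_letter s w"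
      using cons_letter_cancel[of "foldr cons_letter s w" "inv_letter a"]
        reduced_foldr_cons_letter[OF assms] by simp
    then show ?thesis
      by (simp add: t cons_letter_def[of a "inv_letter a # s"])
  qed (auto simp: cons_letter_def[of a t])
  then show ?case
    using Cons by simp
qed simp

lemma foldr_cons_letter_inverse:
  assumes "reduced w"
  shows "foldr cons_letter (rev (map inv_letter u)) (foldr cons_letter u w) = w"
  using assms
proof (induction u arbitrary: w)
  case (Cons a u)
  then show ?case
    by (simp add: cons_letter_cancel reduced_foldr_cons_letter)
qed simp

lemma reduced_inverse: "reduced u \<Longrightarrow> reduced (rev (map inv_letter u))"
proof -
  have "successively (\<lambda>a b. inv_letter a \<noteq> inv_letter (inv_letter b)) u" if "reduced u"
    using that unfolding reduced_def
    by (rule successively_mono) (metis inv_letter_inv_letter)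
  then show "reduced u \<Longrightarrow> reduced (rev (map inv_letter u))"
    by (simp add: reduced_def successively_rev successively_map)
qed

lemma group_free_group: "group (free_group X)"
proof (rule groupI)
  fix u v assume "u \<in> carrier (free_group X)" "v \<in> carrier (free_group X)"
  then show "u \<otimes>\<^bsub>free_group X\<^esub> v \<in> carrier (free_group X)"
    using set_foldr_cons_letter[of u v] by (auto simp: free_group_def reduced_foldr_cons_letter)
next
  fix u assume u: "u \<in> carrier (free_group X)"
  let ?u' = "rev (map inv_letter u)"
  have "?u' \<in> carrier (free_group X)"
    using u by (force simp: free_group_def reduced_inverse mem_Times_iff)
  moreover have "foldr cons_letter ?u' u = []"
    using u foldr_cons_letter_inverse[of "[]" u] by (simp add: free_group_def foldr_cons_letter_Nil)
  ultimately show "\<exists>v\<in>carrier (free_group X). v \<otimes>\<^bsub>free_group X\<^esub> u = \<one>\<^bsub>free_group X\<^esub>"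
    by (intro bexI[of _ ?u']) (simp_all add: free_group_def)
qed (auto simp: free_group_def foldr_cons_letter_assoc)

lemma reduced_append:
  "reduced (u @ v) \<longleftrightarrow> reduced u \<and> reduced v \<and> (u = [] \<or> v = [] \<or> hd v \<noteq> inv_letter (last u))"
  by (auto simp: reduced_def successively_append_iff)

lemma foldr_cons_letter_append: "reduced (u @ v) \<Longrightarrow> foldr cons_letter u v = u @ v"
  by (induction u) (auto simp: cons_letter_def reduced_Cons)

lemma free_group_pow_word:
  assumes "s \<in> carrier (free_group X)" "s \<noteq> []" "n > 0"
  shows "s [^]\<^bsub>free_group X\<^esub> (n :: nat) \<noteq> [] \<and>
    hd (s [^]\<^bsub>free_group X\<^esub> n) = hd s \<and> last (s [^]\<^bsub>free_group X\<^esub> n) = last s \<and>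
    n \<le> length (s [^]\<^bsub>free_group X\<^esub> n)"
  using assms
proof (induction "length s" arbitrary: s n rule: less_induct)
  case less
  interpret F: group "free_group X"
    by (rule group_free_group)
  note s = less.prems(1,2)
  have mult: "u \<otimes>\<^bsub>free_group X\<^esub> v = u @ v" if "reduced (u @ v)" for u v
    using foldr_cons_letter_append[OF that] by (simp add: free_group_def)
  have red: "reduced u" if "u \<in> carrier (free_group X)" for u
    using that by (simp add: free_group_def)
  show ?case
  proof (cases "hd s = inv_letter (last s)")
    case False
    have "s [^]\<^bsub>free_group X\<^esub> Suc k \<noteq> [] \<and> hd (s [^]\<^bsub>free_group X\<^esub> Suc k) = hd s \<and>
        last (s [^]\<^bsub>free_group X\<^esub> Suc k) = last s \<and> Suc k \<le> length (s [^]\<^bsub>free_group X\<^esub> Suc k)" for k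
    proof (induction k)
      case 0
      then show ?case using s by (cases s) (simp_all add: F.nat_pow_Suc)
    next
      case (Suc k)
      let ?t = "s [^]\<^bsub>free_group X\<^esub> Suc k"
      have "reduced (?t @ s)"
        using Suc False red[of ?t] red[of s] s F.nat_pow_closed[of s "Suc k"]
        by (auto simp: reduced_append simp del: F.nat_pow_Suc)
      then have "s [^]\<^bsub>free_group X\<^esub> Suc (Suc k) = ?t @ s"
        using mult by (metis F.nat_pow_Suc)
      then show ?case
        using Suc s by (cases s) (auto simp del: F.nat_pow_Suc)
    qed
    from this[of "n - 1"] less.prems(3) show ?thesis by simp
  next
    case True
    define a where "a = hd s"
    obtain s' where s': "s = a # s'"
      using s by (cases s) (auto simp: a_def)
    have "s' \<noteq> []"
      using True s' a_def by (metis inv_letter_neq last.simps list.sel(1))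
    then obtain t where t: "s = a # t @ [inv_letter a]"
      using True s' a_def by (metis append_butlast_last_id inv_letter_inv_letter last.simps)
    have "t \<noteq> []"
      using red[OF s(1)] by (auto simp: t reduced_Cons)
    have tX: "t \<in> carrier (free_group X)" and aX: "[a] \<in> carrier (free_group X)"
      and bX: "[inv_letter a] \<in> carrier (free_group X)"
      using s(1) by (auto simp: t free_group_def reduced_Cons reduced_append)
    have conj: "[a] \<otimes>\<^bsub>free_group X\<^esub> u \<otimes>\<^bsub>free_group X\<^esub> [inv_letter a] = a # u @ [inv_letter a]"
      if "u \<in> carrier (free_group X)" "u \<noteq> []" "hd u = hd t" "last u = last t" for u
    proof -
      have "reduced (a # u @ [inv_letter a])"
        using red[OF s(1)] red[OF that(1)] that(2-4) \<open>t \<noteq> []\<close>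
        by (auto simp: t reduced_Cons reduced_append)
      then have "reduced ([a] @ u)" "reduced ((a # u) @ [inv_letter a])"
        using that(2) by (auto simp: reduced_Cons reduced_append)
      then show ?thesis
        using mult[of "[a]" u] mult[of "a # u" "[inv_letter a]"] by simp
    qed
    have ba: "[inv_letter a] \<otimes>\<^bsub>free_group X\<^esub> [a] = \<one>\<^bsub>free_group X\<^esub>"
      by (simp add: free_group_def cons_letter_def)
    have s_eq: "s = [a] \<otimes>\<^bsub>free_group X\<^esub> t \<otimes>\<^bsub>free_group X\<^esub> [inv_letter a]"
      using conj[OF tX] \<open>t \<noteq> []\<close> t by simp
    have pow: "s [^]\<^bsub>free_group X\<^esub> Suc k =
        [a] \<otimes>\<^bsub>free_group X\<^esub> (t [^]\<^bsub>free_group X\<^esub> Suc k) \<otimes>\<^bsub>free_group X\<^esub> [inv_letter a]" for k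
    proof (induction k)
      case 0
      then show ?case using s_eq s tX by (simp add: F.nat_pow_Suc)
    next
      case (Suc k)
      let ?T = "t [^]\<^bsub>free_group X\<^esub> Suc k"
      have T: "?T \<in> carrier (free_group X)"
        using tX by (rule F.nat_pow_closed)
      have "s [^]\<^bsub>free_group X\<^esub> Suc (Suc k) =
          ([a] \<otimes>\<^bsub>free_group X\<^esub> ?T \<otimes>\<^bsub>free_group X\<^esub> [inv_letter a]) \<otimes>\<^bsub>free_group X\<^esub>
          ([a] \<otimes>\<^bsub>free_group X\<^esub> t \<otimes>\<^bsub>free_group X\<^esub> [inv_letter a])"
        using Suc s_eq by (metis F.nat_pow_Suc)
      also have "\<dots> = [a] \<otimes>\<^bsub>free_group X\<^esub> ?T \<otimes>\<^bsub>free_group X\<^esub>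
          ([inv_letter a] \<otimes>\<^bsub>free_group X\<^esub> [a]) \<otimes>\<^bsub>free_group X\<^esub> t \<otimes>\<^bsub>free_group X\<^esub> [inv_letter a]"
        using T tX aX bX by (simp add: F.m_assoc del: F.nat_pow_Suc)
      also have "\<dots> = [a] \<otimes>\<^bsub>free_group X\<^esub> (?T \<otimes>\<^bsub>free_group X\<^esub> t) \<otimes>\<^bsub>free_group X\<^esub> [inv_letter a]"
        using T tX aX bX by (simp add: ba F.m_assoc del: F.nat_pow_Suc)
      finally show ?case
        by (metis F.nat_pow_Suc)
    qed
    have "length t < length s"
      by (simp add: t)
    note IH = less.hyps[OF this tX \<open>t \<noteq> []\<close> less.prems(3)]
    have "s [^]\<^bsub>free_group X\<^esub> n = a # (t [^]\<^bsub>free_group X\<^esub> n) @ [inv_letter a]"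
      using pow[of "n - 1"] less.prems(3) conj[OF F.nat_pow_closed[OF tX, of n]] IH by simp
    then show ?thesis
      using IH by (simp add: t)
  qed
qed


section \<open>Presentations and $p$-deficiency\<close>

definition normal_closure :: "('a, 'b) monoid_scheme \<Rightarrow> 'a set \<Rightarrow> 'a set" where
  "normal_closure G R = \<Inter>{N. N \<lhd> G \<and> R \<subseteq> N}"

definition presents :: "'a set \<Rightarrow> 'a word set \<Rightarrow> ('g, 'm) monoid_scheme \<Rightarrow> bool" where
  "presents X R G \<longleftrightarrow>
    R \<subseteq> carrier (free_group X) \<and>
    free_group X Mod normal_closure (free_group X) R \<cong> G"

definition finitely_generated :: "('g, 'm) monoid_scheme \<Rightarrow> bool" where
  "finitely_generated G \<longleftrightarrow> (\<exists>S. finite S \<and> S \<subseteq> carrier G \<and> generate G S = carrier G)"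

definition p_order :: "'a set \<Rightarrow> nat \<Rightarrow> 'a word \<Rightarrow> enat" where
  "p_order X p r =
    (if r = \<one>\<^bsub>free_group X\<^esub> then \<infinity>
     else enat (GREATEST k. \<exists>s\<in>carrier (free_group X). r = s [^]\<^bsub>free_group X\<^esub> (p ^ k)))"

text \<open>Since an \<open>n\<close>-th power other than \<open>\<one>\<close> has length at least \<open>n\<close>, the maximum exists.\<close>

lemma p_order_attained:
  assumes "prime p" "r \<in> carrier (free_group X)" "r \<noteq> \<one>\<^bsub>free_group X\<^esub>"
  obtains k s where "p_order X p r = enat k" "s \<in> carrier (free_group X)"
    "r = s [^]\<^bsub>free_group X\<^esub> (p ^ k)"
    "\<And>l t. t \<in> carrier (free_group X) \<Longrightarrow> r = t [^]\<^bsub>free_group X\<^esub> (p ^ l) \<Longrightarrow> l \<le> k"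
proof -
  interpret F: group "free_group X"
    by (rule group_free_group)
  let ?P = "\<lambda>k. \<exists>s\<in>carrier (free_group X). r = s [^]\<^bsub>free_group X\<^esub> (p ^ k)"
  have bound: "k \<le> length r" if "?P k" for k
  proof -
    from that obtain s where s: "s \<in> carrier (free_group X)" "r = s [^]\<^bsub>free_group X\<^esub> (p ^ k)"
      by blast
    have "s \<noteq> []"
    proof
      assume "s = []"
      then have "s = \<one>\<^bsub>free_group X\<^esub>"
        by (simp add: free_group_def)
      then show False
        using s assms(3) by simp
    qed
    then have "p ^ k \<le> length r"
      using free_group_pow_word[OF s(1), of "p ^ k"] s(2) prime_gt_0_nat[OF assms(1)] by simp
    moreover have "k < p ^ k"
      using prime_gt_1_nat[OF assms(1)] by (simp add: power_gt_expt)
    ultimately show ?thesis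
      by linarith
  qed
  have P0: "?P 0"
    using assms(2) by (intro bexI[of _ r]) simp_all
  have "?P (Greatest ?P)"
    using GreatestI_nat[of ?P, OF P0] bound by blast
  moreover have "l \<le> Greatest ?P" if "?P l" for l
    using Greatest_le_nat[of ?P, OF that] bound by blast
  moreover have "p_order X p r = enat (Greatest ?P)"
    using assms(3) by (simp add: p_order_def)
  ultimately show ?thesis
    using that by blast
qed

definition p_weight :: "'a set \<Rightarrow> nat \<Rightarrow> 'a word \<Rightarrow> real" where
  "p_weight X p r = (case p_order X p r of enat k \<Rightarrow> 1 / real p ^ k | \<infinity> \<Rightarrow> 0)"

definition presentation_p_deficiency :: "nat \<Rightarrow> 'a set \<Rightarrow> 'a word set \<Rightarrow> ereal" where
  "presentation_p_deficiency p X R =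
    (if p_weight X p summable_on R
     then ereal (real (card X) - 1 - (\<Sum>\<^sub>\<infinity>r\<in>R. p_weight X p r))
     else - \<infinity>)"

text \<open>
  Generators are taken from \<open>nat\<close>: every presentation with a finite generating set can be
  relabelled to one of this form, with the same $p$-deficiency.
\<close>

definition p_deficiency :: "nat \<Rightarrow> ('g, 'm) monoid_scheme \<Rightarrow> ereal" where
  "p_deficiency p G =
    Sup {presentation_p_deficiency p X R | (X :: nat set) R. finite X \<and> presents X R G}"

end

theory Submission
  imports Defs "HOL-Algebra.Multiplicative_Group" "HOL-Library.Nat_Bijection"
begin

text \<open>
  Let \<open>\<langle>X | R\<rangle>\<close> present \<open>\<Gamma>\<close> and let \<open>H\<close> be the preimage of \<open>\<Delta>\<close> in the free group \<open>F\<close> on \<open>X\<close>, a normal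
  subgroup of index \<open>p\<close>. It suffices to present \<open>\<Delta>\<close> with at least \<open>p\<close> times the \<open>p\<close>-deficiency
  (\<open>presentation_of_prime_index_subgroup\<close>); the claim follows by taking suprema.

  By Nielsen and Schreier, \<open>H\<close> is free of rank \<open>p (|X| - 1) + 1\<close>, so the generators contribute exactly
  \<open>p (|X| - 1)\<close>. As the index is prime, the powers \<open>x0^i\<close> of a generator \<open>x0 \<notin> H\<close> with \<open>i < p\<close> are a
  Schreier transversal, which keeps the free basis explicit (locale \<open>cyclic_transversal\<close>).

  The kernel of \<open>H \<rightarrow> \<Delta>\<close> is the normal closure of \<open>R\<close> in \<open>F\<close>. As a normal subgroup of \<open>H\<close>, this kernel is
  generated by representatives of the \<open>H\<close>-classes into which the \<open>F\<close>-class of each relator splits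
  (\<open>normal_closure_conjugate_systems\<close>). For a relator \<open>r = s^(p^k)\<close> either \<open>s \<in> H\<close>, and \<open>p\<close> conjugates
  that are still \<open>p^k\<close>-th powers in \<open>H\<close> suffice; or \<open>s \<notin> H\<close>, and \<open>r\<close> alone suffices because the powers
  of its root represent \<open>F / H\<close>, but only \<open>s^p\<close> survives as a root. Either way the weight of \<open>r\<close> is
  multiplied by at most \<open>p\<close> (\<open>relator_conjugates\<close>).
\<close>

section \<open>Normal closures and kernels\<close>

lemma normal_closure_normal:
  assumes "group G" "R \<subseteq> carrier G"
  shows "normal_closure G R \<lhd> G"
proof -
  interpret group G by fact
  let ?S = "{N. N \<lhd> G \<and> R \<subseteq> N}"
  have top: "carrier G \<in> ?S"
    using assms(2) by (auto simp: normal_inv_iff subgroup_self)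
  have "subgroup (\<Inter>?S) G"
    using top by (intro subgroups_Inter) (auto simp: normal_inv_iff)
  then show ?thesis
    unfolding normal_closure_def normal_inv_iff by (auto simp: normal_inv_iff)
qed

lemma normal_closure_superset: "R \<subseteq> normal_closure G R"
  by (auto simp: normal_closure_def)

lemma normal_closure_least: "N \<lhd> G \<Longrightarrow> R \<subseteq> N \<Longrightarrow> normal_closure G R \<subseteq> N"
  by (auto simp: normal_closure_def)

lemma normal_closure_generate:
  fixes G (structure)
  assumes "group G" "R \<subseteq> carrier G"
  shows "normal_closure G R \<subseteq> generate G {g \<otimes>\<^bsub>G\<^esub> r \<otimes>\<^bsub>G\<^esub> inv\<^bsub>G\<^esub> g | g r. g \<in> carrier G \<and> r \<in> R}"
    (is "_ \<subseteq> generate G ?D")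
proof (rule normal_closure_least)
  interpret group G by fact
  show "generate G ?D \<lhd> G"
  proof (rule normal_generateI)
    show "?D \<subseteq> carrier G"
      using assms(2) by blast
    fix d h assume "d \<in> ?D" and h: "h \<in> carrier G"
    then obtain g r where g: "g \<in> carrier G" "r \<in> R" "d = g \<otimes> r \<otimes> inv g"
      by blast
    moreover have "r \<in> carrier G"
      using g assms(2) by blast
    ultimately have "h \<otimes> d \<otimes> inv h = (h \<otimes> g) \<otimes> r \<otimes> inv (h \<otimes> g)"
      using h by (simp add: m_assoc inv_mult_group)
    then show "h \<otimes> d \<otimes> inv h \<in> ?D"
      using g h m_closed by blast
  qed
  show "R \<subseteq> generate G ?D"
  proof
    fix r assume r: "r \<in> R"
    then have "r = \<one> \<otimes> r \<otimes> inv \<one>"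
      using assms(2) by auto
    then have "r \<in> ?D"
      using r one_closed by blast
    then show "r \<in> generate G ?D"
      by (rule generate.incl)
  qed
qed

text \<open>
  Working with an epimorphism from the free group and its kernel avoids handling cosets of the
  normal closure when passing to a subgroup.
\<close>

lemma presents_iff_hom:
  fixes G :: "('g, 'm) monoid_scheme"
  assumes "group G"
  shows "presents X R G \<longleftrightarrow> R \<subseteq> carrier (free_group X) \<and>
    (\<exists>f\<in>hom (free_group X) G. f ` carrier (free_group X) = carrier G \<and>
      kernel (free_group X) G f = normal_closure (free_group X) R)"
proof (cases "R \<subseteq> carrier (free_group X)")
  case R: True
  interpret F: group "free_group X"
    by (rule group_free_group)
  interpret G: group G by fact
  let ?F = "free_group X" and ?N = "normal_closure (free_group X) R"
  interpret N: normal ?N ?F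
    using R by (rule normal_closure_normal[OF group_free_group])
  have "\<exists>f\<in>hom ?F G. f ` carrier ?F = carrier G \<and> kernel ?F G f = ?N" if "presents X R G"
  proof -
    from that obtain h where h: "h \<in> iso (?F Mod ?N) G"
      by (auto simp: presents_def is_iso_def)
    let ?f = "h \<circ> (\<lambda>a. ?N #>\<^bsub>?F\<^esub> a)"
    interpret h: group_hom "?F Mod ?N" G h
      using h N.factorgroup_is_group by (auto simp: group_hom_def group_hom_axioms_def iso_def G.is_group)
    have inj: "inj_on h (carrier (?F Mod ?N))" and surj: "h ` carrier (?F Mod ?N) = carrier G"
      using h by (auto simp: iso_def bij_betw_def)
    have car: "carrier (?F Mod ?N) = (\<lambda>a. ?N #>\<^bsub>?F\<^esub> a) ` carrier ?F"
      by (auto simp: FactGroup_def RCOSETS_def)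
    have "?f \<in> hom ?F G"
      using N.r_coset_hom_Mod h.homh by (rule Group.hom_compose)
    moreover have "?f ` carrier ?F = carrier G"
      using surj car by (metis image_comp)
    moreover have "kernel ?F G ?f = ?N"
    proof -
      have "h (?N #>\<^bsub>?F\<^esub> a) = \<one>\<^bsub>G\<^esub> \<longleftrightarrow> a \<in> ?N" if a: "a \<in> carrier ?F" for a
      proof -
        have "h (?N #>\<^bsub>?F\<^esub> a) = \<one>\<^bsub>G\<^esub> \<longleftrightarrow> h (?N #>\<^bsub>?F\<^esub> a) = h ?N"
          using h.hom_one by (simp add: FactGroup_def)
        also have "\<dots> \<longleftrightarrow> ?N #>\<^bsub>?F\<^esub> a = ?N"
          using inj_on_eq_iff[OF inj, of "?N #>\<^bsub>?F\<^esub> a" ?N] a car N.subgroup_in_rcosets[OF group_free_group]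
          by (auto simp: FactGroup_def)
        also have "\<dots> \<longleftrightarrow> a \<in> ?N"
          using a F.coset_join1[OF _ a N.subgroup_axioms] F.coset_join2[OF a N.subgroup_axioms] by blast
        finally show ?thesis .
      qed
      then show ?thesis
        using N.subset by (auto simp: kernel_def)
    qed
    ultimately show ?thesis by blast
  qed
  moreover have "presents X R G" if f: "f \<in> hom ?F G" "f ` carrier ?F = carrier G" "kernel ?F G f = ?N" for f
  proof -
    interpret f: group_hom ?F G f
      using f by (simp add: group_hom_def group_hom_axioms_def F.is_group G.is_group)
    show ?thesis
      using f.FactGroup_iso f R by (simp add: presents_def)
  qed
  ultimately show ?thesis
    using R by blast
qed (simp add: presents_def)

text \<open>
  Let \<open>f\<close> embed \<open>G\<close> into \<open>F\<close>. A conjugacy class of \<open>F\<close> that lies in the image of \<open>f\<close> is a union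
  of conjugacy classes of \<open>G\<close>; the set \<open>C\<close> represents all of them, for the class of \<open>r\<close>.
\<close>

definition conjugate_system ::
  "('a, 'm) monoid_scheme \<Rightarrow> ('b, 'n) monoid_scheme \<Rightarrow> ('b \<Rightarrow> 'a) \<Rightarrow> 'a \<Rightarrow> 'b set \<Rightarrow> bool" where
  "conjugate_system F G f r C \<longleftrightarrow> C \<subseteq> carrier G \<and>
    (\<forall>c\<in>C. \<exists>g\<in>carrier F. f c = g \<otimes>\<^bsub>F\<^esub> r \<otimes>\<^bsub>F\<^esub> inv\<^bsub>F\<^esub> g) \<and>
    (\<forall>g\<in>carrier F. \<exists>h\<in>carrier G. \<exists>c\<in>C.
      g \<otimes>\<^bsub>F\<^esub> r \<otimes>\<^bsub>F\<^esub> inv\<^bsub>F\<^esub> g = f (h \<otimes>\<^bsub>G\<^esub> c \<otimes>\<^bsub>G\<^esub> inv\<^bsub>G\<^esub> h))"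

lemma conjugate_system_subset: "conjugate_system F G f r C \<Longrightarrow> C \<subseteq> carrier G"
  by (simp add: conjugate_system_def)

text \<open>
  The normal closure of \<open>R\<close> in \<open>F\<close> is generated by the \<open>F\<close>-conjugates of \<open>R\<close>. These are the
  \<open>G\<close>-conjugates of the representatives, so the normal closure of the representatives in the
  smaller group \<open>G\<close> already contains everything. This turns the relators of a group into relators
  of a subgroup.
\<close>

lemma normal_closure_conjugate_systems:
  assumes "group G" "group F" and hom: "f \<in> hom G F" and inj: "inj_on f (carrier G)"
    and R: "R \<subseteq> carrier F" and sys: "\<And>r. r \<in> R \<Longrightarrow> conjugate_system F G f r (C r)"
  shows "normal_closure G (\<Union>r\<in>R. C r) = {w \<in> carrier G. f w \<in> normal_closure F R}"
proof (rule equalityI)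
  interpret F: group F by fact
  interpret G: group G by fact
  interpret f: group_hom G F f
    using hom by (simp add: group_hom_def group_hom_axioms_def F.is_group G.is_group)
  let ?C = "\<Union>r\<in>R. C r"
  have C: "?C \<subseteq> carrier G"
    by (intro UN_least conjugate_system_subset[OF sys])
  interpret NF: normal "normal_closure F R" F
    using assms(2) R by (rule normal_closure_normal)
  interpret NG: normal "normal_closure G ?C" G
    using assms(1) C by (rule normal_closure_normal)
  let ?P = "{w \<in> carrier G. f w \<in> normal_closure F R}"
  have "subgroup ?P G"
    by (rule G.subgroupI) (auto intro: exI[of _ "\<one>\<^bsub>G\<^esub>"])
  then have "?P \<lhd> G"
    by (auto simp: G.normal_inv_iff NF.inv_op_closed2)
  moreover have "f c \<in> normal_closure F R" if rc: "r \<in> R" "c \<in> C r" for r c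
  proof -
    obtain g where g: "g \<in> carrier F" "f c = g \<otimes>\<^bsub>F\<^esub> r \<otimes>\<^bsub>F\<^esub> inv\<^bsub>F\<^esub> g"
      using sys[OF rc(1)] rc(2) by (auto simp: conjugate_system_def)
    then show ?thesis
      using NF.inv_op_closed2[OF g(1) subsetD[OF normal_closure_superset rc(1)]] by simp
  qed
  ultimately show "normal_closure G ?C \<subseteq> ?P"
    using C by (intro normal_closure_least) auto
  show "?P \<subseteq> normal_closure G ?C"
  proof
    fix w assume w: "w \<in> ?P"
    have "generate F {g \<otimes>\<^bsub>F\<^esub> r \<otimes>\<^bsub>F\<^esub> inv\<^bsub>F\<^esub> g | g r. g \<in> carrier F \<and> r \<in> R} \<subseteq> f ` normal_closure G ?C"
    proof (rule F.generate_subgroup_incl)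
      show "subgroup (f ` normal_closure G ?C) F"
        by (rule f.subgroup_img_is_subgroup[OF NG.subgroup_axioms])
      show "{g \<otimes>\<^bsub>F\<^esub> r \<otimes>\<^bsub>F\<^esub> inv\<^bsub>F\<^esub> g | g r. g \<in> carrier F \<and> r \<in> R} \<subseteq> f ` normal_closure G ?C"
      proof clarify
        fix g r assume gr: "g \<in> carrier F" "r \<in> R"
        obtain h c where h: "h \<in> carrier G" "c \<in> C r"
          and eq: "g \<otimes>\<^bsub>F\<^esub> r \<otimes>\<^bsub>F\<^esub> inv\<^bsub>F\<^esub> g = f (h \<otimes>\<^bsub>G\<^esub> c \<otimes>\<^bsub>G\<^esub> inv\<^bsub>G\<^esub> h)"
          using sys[OF gr(2)] gr(1) unfolding conjugate_system_def by metis
        then have cC: "c \<in> ?C"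
          using gr(2) by blast
        have "h \<otimes>\<^bsub>G\<^esub> c \<otimes>\<^bsub>G\<^esub> inv\<^bsub>G\<^esub> h \<in> normal_closure G ?C"
          by (rule NG.inv_op_closed2[OF h(1) subsetD[OF normal_closure_superset cC]])
        then show "g \<otimes>\<^bsub>F\<^esub> r \<otimes>\<^bsub>F\<^esub> inv\<^bsub>F\<^esub> g \<in> f ` normal_closure G ?C"
          unfolding eq by (rule imageI)
      qed
    qed
    then have "f w \<in> f ` normal_closure G ?C"
      using w normal_closure_generate[OF assms(2) R] by blast
    then show "w \<in> normal_closure G ?C"
      using w inj_on_image_mem_iff[OF inj, of w] NG.subset by blast
  qed
qed

section \<open>Subgroups of prime index\<close>

text \<open>
  The quotient has prime order, so it is cyclic and generated by the coset of any element outside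
  \<open>N\<close>. The freedom in choosing \<open>g\<close> matters: a generator of the free group gives a free basis of the
  subgroup, and the root of a relator gives representatives of the conjugates of that relator.
\<close>

lemma (in group) prime_index_transversal:
  assumes "N \<lhd> G" "prime p" "card (rcosets N) = p" "g \<in> carrier G" "g \<notin> N" "u \<in> carrier G"
  shows "\<exists>!i. i < p \<and> inv (g [^] i) \<otimes> u \<in> N"
proof -
  interpret N: normal N G by fact
  let ?Q = "G Mod N" and ?a = "N #> g"
  interpret Q: group ?Q
    by (rule N.factorgroup_is_group)
  have carQ: "carrier ?Q = rcosets N" and ord: "order ?Q = p"
    using assms(3) by (simp_all add: FactGroup_def order_def)
  have fin: "finite (carrier ?Q)"
    using assms(2,3) prime_gt_0_nat carQ by (metis card.infinite less_irrefl)
  have a: "?a \<in> carrier ?Q"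
    using assms(4) carQ by (auto simp: RCOSETS_def)
  have "?a \<noteq> \<one>\<^bsub>?Q\<^esub>"
    using assms(4,5) coset_join1[OF _ _ N.subgroup_axioms] by (auto simp: FactGroup_def)
  then have "Q.ord ?a \<noteq> 1"
    using Q.ord_eq_1 a by blast
  then have ord_a: "Q.ord ?a = p"
    using Q.ord_dvd_group_order[OF a] assms(2) unfolding ord prime_nat_iff by blast
  have pow: "?a [^]\<^bsub>?Q\<^esub> i = N #> (g [^] i)" for i :: nat
    by (rule N.FactGroup_pow[OF assms(4)])
  have eq: "N #> (g [^] i) = N #> u \<longleftrightarrow> inv (g [^] i) \<otimes> u \<in> N" for i :: nat
  proof -
    have gi: "g [^] i \<in> carrier G"
      using assms(4) by simp
    have "N #> (g [^] i) = N #> u \<longleftrightarrow> u \<in> N #> (g [^] i)"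
      using repr_independence[OF _ gi N.subgroup_axioms, of u]
        repr_independenceD[OF N.subgroup_axioms assms(6), of "g [^] i"] by metis
    also have "\<dots> \<longleftrightarrow> u \<in> (g [^] i) <# N"
      using gi N.coset_eq by simp
    also have "\<dots> \<longleftrightarrow> inv (g [^] i) \<otimes> u \<in> N"
    proof
      assume "u \<in> (g [^] i) <# N"
      then show "inv (g [^] i) \<otimes> u \<in> N"
        using gi N.subset by (auto simp: l_coset_def inv_solve_left' subset_iff simp flip: m_assoc)
    next
      assume "inv (g [^] i) \<otimes> u \<in> N"
      moreover have "u = (g [^] i) \<otimes> (inv (g [^] i) \<otimes> u)"
        using gi assms(6) by (simp flip: m_assoc)
      ultimately show "u \<in> (g [^] i) <# N"
        unfolding l_coset_def by blast
    qed
    finally show ?thesis .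
  qed
  have inj: "inj_on (\<lambda>i. ?a [^]\<^bsub>?Q\<^esub> i) {..<p}"
    using Q.ord_inj[OF a] ord_a prime_gt_0_nat[OF assms(2)]
    by (auto simp: inj_on_def)
  moreover have "(\<lambda>i. ?a [^]\<^bsub>?Q\<^esub> i) ` {..<p} = carrier ?Q"
    using a card_image[OF inj] assms(3) carQ by (intro card_subset_eq[OF fin]) auto
  moreover have "N #> u \<in> carrier ?Q"
    using assms(6) carQ by (auto simp: RCOSETS_def)
  ultimately obtain i where "i < p" "?a [^]\<^bsub>?Q\<^esub> i = N #> u"
    by (metis imageE lessThan_iff)
  then have "\<exists>!i. i < p \<and> ?a [^]\<^bsub>?Q\<^esub> i = N #> u"
    by (intro ex1I[of _ i]) (auto intro: inj_onD[OF inj])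
  then show ?thesis
    unfolding pow eq .
qed


section \<open>Words and the universal property of free groups\<close>

lemma carrier_free_group: "w \<in> carrier (free_group X) \<longleftrightarrow> set w \<subseteq> X \<times> UNIV \<and> reduced w"
  by (simp add: free_group_def)

lemma mult_free_group: "u \<otimes>\<^bsub>free_group X\<^esub> v = foldr cons_letter u v"
  by (simp add: free_group_def)

lemma one_free_group: "\<one>\<^bsub>free_group X\<^esub> = []"
  by (simp add: free_group_def)

lemma letter_in_free_group: "[a] \<in> carrier (free_group X) \<longleftrightarrow> fst a \<in> X"
  by (cases a) (auto simp: carrier_free_group reduced_Cons)

lemma Cons_in_free_group:
  assumes "a # w \<in> carrier (free_group X)"
  shows "fst a \<in> X" "w \<in> carrier (free_group X)" "[a] \<otimes>\<^bsub>free_group X\<^esub> w = a # w"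
  using assms by (auto simp: carrier_free_group reduced_Cons mult_free_group cons_letter_def)

lemma inv_free_group:
  assumes "w \<in> carrier (free_group X)"
  shows "inv\<^bsub>free_group X\<^esub> w = rev (map inv_letter w)"
proof -
  interpret F: group "free_group X" by (rule group_free_group)
  have "rev (map inv_letter w) \<in> carrier (free_group X)"
    using assms by (force simp: carrier_free_group reduced_inverse mem_Times_iff)
  moreover have "rev (map inv_letter w) \<otimes>\<^bsub>free_group X\<^esub> w = \<one>\<^bsub>free_group X\<^esub>"
    using assms foldr_cons_letter_inverse[of "[]" w]
    by (simp add: carrier_free_group mult_free_group one_free_group foldr_cons_letter_Nil)
  ultimately show ?thesis
    using F.inv_equality assms by blast
qed

lemma inv_letter_free_group:
  assumes "fst a \<in> X"
  shows "inv\<^bsub>free_group X\<^esub> [a] = [inv_letter a]"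
  using inv_free_group[of "[a]" X] assms by (simp add: letter_in_free_group)

text \<open>
  An action of the letters on a set \<open>S\<close> in which inverse letters act inversely extends to an action
  of the free group, because cancelling \<open>a\<close> against its inverse does not change the effect.
\<close>

lemma foldr_action_closed:
  assumes "\<And>a z. fst a \<in> X \<Longrightarrow> z \<in> S \<Longrightarrow> act a z \<in> S"
    and "set u \<subseteq> X \<times> UNIV" "z \<in> S"
  shows "foldr act u z \<in> S"
  using assms(2) by (induction u) (use assms in auto)

lemma foldr_action_mult:
  assumes closed: "\<And>a z. fst a \<in> X \<Longrightarrow> z \<in> S \<Longrightarrow> act a z \<in> S"
    and inverse: "\<And>a z. fst a \<in> X \<Longrightarrow> z \<in> S \<Longrightarrow> act a (act (inv_letter a) z) = z"
    and "set u \<subseteq> X \<times> UNIV" "set v \<subseteq> X \<times> UNIV" "z \<in> S"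
  shows "foldr act (foldr cons_letter u v) z = foldr act u (foldr act v z)"
  using assms(3)
proof (induction u)
  case (Cons a u)
  then have a: "fst a \<in> X"
    by auto
  have "foldr act (cons_letter a t) z = act a (foldr act t z)" if t: "set t \<subseteq> X \<times> UNIV" for t
  proof (cases "t \<noteq> [] \<and> hd t = inv_letter a")
    case True
    then obtain s where s: "t = inv_letter a # s"
      by (cases t) auto
    then have "foldr act s z \<in> S"
      using t by (intro foldr_action_closed[of X, OF closed]) (use assms in auto)
    then show ?thesis
      by (simp add: s cons_letter_def inverse[OF a])
  qed (auto simp: cons_letter_def)
  moreover have "set (foldr cons_letter u v) \<subseteq> X \<times> UNIV"
    using Cons.prems assms(4) set_foldr_cons_letter[of u v] by auto
  ultimately show ?case
    using Cons by simp
qed simp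

text \<open>
  The value of a word under an assignment \<open>f\<close> of group elements to the generators, obtained by letting
  the letters act on \<open>\<one>\<close> by left multiplication; the homomorphism property is then an instance of
  \<open>foldr_action_mult\<close>.
\<close>

definition eval_letter :: "('g, 'm) monoid_scheme \<Rightarrow> ('a \<Rightarrow> 'g) \<Rightarrow> 'a \<times> bool \<Rightarrow> 'g \<Rightarrow> 'g" where
  "eval_letter G f a z = (if snd a then f (fst a) else inv\<^bsub>G\<^esub> f (fst a)) \<otimes>\<^bsub>G\<^esub> z"

definition eval_word :: "('g, 'm) monoid_scheme \<Rightarrow> ('a \<Rightarrow> 'g) \<Rightarrow> 'a word \<Rightarrow> 'g" where
  "eval_word G f w = foldr (eval_letter G f) w \<one>\<^bsub>G\<^esub>"

lemma eval_word_in_subgroup: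
  fixes G (structure)
  assumes "group G" "subgroup H G" "\<And>x. x \<in> X \<Longrightarrow> f x \<in> H" "set w \<subseteq> X \<times> UNIV"
  shows "eval_word G f w \<in> H"
proof -
  interpret group G by fact
  interpret H: subgroup H G by fact
  show ?thesis
    unfolding eval_word_def
    by (rule foldr_action_closed[of X, OF _ assms(4)]) (use assms(3) in \<open>auto simp: eval_letter_def\<close>)
qed

lemma eval_word_hom:
  fixes G (structure)
  assumes "group G" "\<And>x. x \<in> X \<Longrightarrow> f x \<in> carrier G"
  shows "eval_word G f \<in> hom (free_group X) G"
proof -
  interpret group G by fact
  have closed: "eval_letter G f a z \<in> carrier G" if "fst a \<in> X" "z \<in> carrier G" for a z
    using that assms(2) by (auto simp: eval_letter_def)
  have inverse: "eval_letter G f a (eval_letter G f (inv_letter a) z) = z"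
    if "fst a \<in> X" "z \<in> carrier G" for a z
    using that assms(2)[of "fst a"] by (cases a) (auto simp: eval_letter_def simp flip: m_assoc)
  have foldr_eval: "foldr (eval_letter G f) u z = eval_word G f u \<otimes> z"
    if "set u \<subseteq> X \<times> UNIV" "z \<in> carrier G" for u z
    using that
  proof (induction u)
    case (Cons a u)
    have "eval_word G f u \<in> carrier G"
      using eval_word_in_subgroup[OF assms(1) subgroup_self assms(2), where X=X and w=u] Cons.prems by simp
    then show ?case
      using Cons assms(2)[of "fst a"] by (auto simp: eval_word_def eval_letter_def m_assoc)
  qed (simp add: eval_word_def)
  show ?thesis
  proof (rule homI)
    fix u v assume uv: "u \<in> carrier (free_group X)" "v \<in> carrier (free_group X)"
    have v: "eval_word G f v \<in> carrier G" if "v \<in> carrier (free_group X)" for v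
      using that eval_word_in_subgroup[OF assms(1) subgroup_self assms(2), where X=X and w=v]
      by (simp add: carrier_free_group)
    from v uv show "eval_word G f u \<in> carrier G"
      by simp
    have "eval_word G f (u \<otimes>\<^bsub>free_group X\<^esub> v) = foldr (eval_letter G f) u (eval_word G f v)"
      unfolding eval_word_def mult_free_group
      using uv by (intro foldr_action_mult[of X "carrier G" "eval_letter G f", OF closed inverse])
        (auto simp: carrier_free_group)
    also have "\<dots> = eval_word G f u \<otimes> eval_word G f v"
      using uv v by (intro foldr_eval) (auto simp: carrier_free_group)
    finally show "eval_word G f (u \<otimes>\<^bsub>free_group X\<^esub> v) = eval_word G f u \<otimes> eval_word G f v" .
  qed
qed

lemma eval_word_Cons: "eval_word G f (a # w) = eval_letter G f a (eval_word G f w)"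
  by (simp add: eval_word_def)

lemma eval_word_id:
  assumes "w \<in> carrier (free_group X)"
  shows "eval_word (free_group X) (\<lambda>x. [(x, True)]) w = w"
  using assms
proof (induction w)
  case (Cons a w)
  note w = Cons_in_free_group[OF Cons.prems]
  have "eval_letter (free_group X) (\<lambda>x. [(x, True)]) a w = [a] \<otimes>\<^bsub>free_group X\<^esub> w"
    using w(1) inv_letter_free_group[of "(fst a, True)" X] by (cases a) (auto simp: eval_letter_def)
  then show ?case
    using Cons.IH[OF w(2)] w(3) by (simp add: eval_word_Cons)
qed (simp add: eval_word_def one_free_group)

lemma free_group_subgroup_eq:
  assumes "subgroup H (free_group X)" "\<And>x. x \<in> X \<Longrightarrow> [(x, True)] \<in> H"
  shows "H = carrier (free_group X)"
proof
  show "carrier (free_group X) \<subseteq> H"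
  proof
    fix w assume w: "w \<in> carrier (free_group X)"
    then have "eval_word (free_group X) (\<lambda>x. [(x, True)]) w \<in> H"
      by (intro eval_word_in_subgroup[OF group_free_group assms(1), of X])
        (auto simp: carrier_free_group assms(2))
    then show "w \<in> H"
      using eval_word_id[OF w] by simp
  qed
qed (rule subgroup.subset[OF assms(1)])

section \<open>A free basis of a subgroup of cyclic index\<close>

text \<open>
  Reidemeister--Schreier for a subgroup \<open>H\<close> whose left cosets are represented by \<open>1, x0, \<dots>, x0^(p-1)\<close>.
  The Schreier generators are \<open>x0^(-j) x x0^i\<close> for generators \<open>x\<close> and \<open>i < p\<close>, where \<open>x0^j\<close> represents
  the coset of \<open>x x0^i\<close>. Those with \<open>x = x0\<close> and \<open>i < p - 1\<close> are trivial, and the others form a free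
  basis of \<open>H\<close>.

  To see this, let \<open>F\<close> act on the pairs \<open>(i, w)\<close> of a coset number and a word in the Schreier
  generators, the pair standing for the element \<open>x0^i w\<close>. Multiplying by a letter \<open>x\<close> from the left
  moves the coset number to \<open>j\<close> and prepends the symbol of the Schreier generator of \<open>(x, i)\<close>, and
  this is well defined on words that are not yet evaluated in \<open>F\<close>. The value in \<open>H\<close> of a word \<open>w\<close>
  sends \<open>(0, [])\<close> to \<open>(0, w)\<close>, so \<open>w\<close> can be read off from its value and there are no relations.
  Conversely \<open>u \<in> H\<close> sends \<open>(0, [])\<close> to a pair standing for \<open>u\<close>, whose coset number must be \<open>0\<close>, so
  \<open>u\<close> is the value of a word.
\<close>

locale cyclic_transversal =
  fixes X :: "nat set" and H :: "nat word set" and x0 :: nat and p :: nat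
  assumes H: "subgroup H (free_group X)" and x0: "x0 \<in> X" and p: "p > 0"
    and transversal: "\<And>u. u \<in> carrier (free_group X) \<Longrightarrow>
      \<exists>!i. i < p \<and> inv\<^bsub>free_group X\<^esub> ([(x0, True)] [^]\<^bsub>free_group X\<^esub> i) \<otimes>\<^bsub>free_group X\<^esub> u \<in> H"
begin

abbreviation F where "F \<equiv> free_group X"

sublocale F: group F
  by (rule group_free_group)

sublocale H: subgroup H F
  by (rule H)

definition rep :: "nat \<Rightarrow> nat word" where
  "rep i = [(x0, True)] [^]\<^bsub>F\<^esub> i"

definition index :: "nat word \<Rightarrow> nat" where
  "index u = (THE i. i < p \<and> inv\<^bsub>F\<^esub> rep i \<otimes>\<^bsub>F\<^esub> u \<in> H)"

definition move :: "nat \<times> bool \<Rightarrow> nat \<Rightarrow> nat" where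
  "move a i = index ([a] \<otimes>\<^bsub>F\<^esub> rep i)"

text \<open>
  The Schreier generators are named by encoded pairs, so that the free group on them again has
  natural numbers as generators.
\<close>

definition basis :: "nat set" where
  "basis = prod_encode ` (X \<times> {..<p} - {x0} \<times> {..<p - 1})"

definition gen :: "nat \<Rightarrow> nat word" where
  "gen y = (case prod_decode y of (x, i) \<Rightarrow>
     inv\<^bsub>F\<^esub> rep (move (x, True) i) \<otimes>\<^bsub>F\<^esub> ([(x, True)] \<otimes>\<^bsub>F\<^esub> rep i))"

text \<open>
  For a negative letter the Schreier generator involved is the one of the pair reached, not of the
  pair left, since the step undoes a positive one. The index \<open>m\<close> covers both signs.
\<close>

definition act :: "nat \<times> bool \<Rightarrow> nat \<times> nat word \<Rightarrow> nat \<times> nat word" where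
  "act a z = (let i = fst z; m = (if snd a then i else move a i) in
     (move a i, if fst a = x0 \<and> m < p - 1 then snd z
                else cons_letter (prod_encode (fst a, m), snd a) (snd z)))"

definition states :: "(nat \<times> nat word) set" where
  "states = {..<p} \<times> carrier (free_group basis)"

abbreviation emb :: "nat word \<Rightarrow> nat word" where
  "emb \<equiv> eval_word F gen"

definition realize :: "nat \<times> nat word \<Rightarrow> nat word" where
  "realize z = rep (fst z) \<otimes>\<^bsub>F\<^esub> emb (snd z)"

lemma rep_closed [simp]: "rep i \<in> carrier F"
  using x0 by (simp add: rep_def letter_in_free_group)

lemma rep_0: "rep 0 = []"
  by (simp add: rep_def one_free_group)

lemma rep_Suc: "rep (Suc i) = [(x0, True)] \<otimes>\<^bsub>F\<^esub> rep i"
  using x0 by (simp only: rep_def F.nat_pow_Suc2 letter_in_free_group fst_conv)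

lemma index:
  assumes "u \<in> carrier F"
  shows "index u < p" "inv\<^bsub>F\<^esub> rep (index u) \<otimes>\<^bsub>F\<^esub> u \<in> H"
  using theI'[OF transversal[OF assms]] by (simp_all add: index_def rep_def)

lemma index_eq:
  assumes "u \<in> carrier F" "i < p" "inv\<^bsub>F\<^esub> rep i \<otimes>\<^bsub>F\<^esub> u \<in> H"
  shows "index u = i"
  using transversal[OF assms(1)] index[OF assms(1)] assms(2,3) unfolding rep_def by blast

lemma index_rep: "i < p \<Longrightarrow> index (rep i) = i"
  by (rule index_eq) (auto simp: H.one_closed)

lemma move_closed: "fst a \<in> X \<Longrightarrow> move a i < p"
  unfolding move_def by (rule index) (simp add: letter_in_free_group)

lemma move_inverse:
  assumes a: "fst a \<in> X" and i: "i < p"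
  shows "move (inv_letter a) (move a i) = i"
proof -
  let ?j = "move a i" and ?a = "[a]" and ?b = "[inv_letter a]"
  have car: "?a \<in> carrier F" "?b \<in> carrier F"
    using a by (simp_all add: letter_in_free_group)
  have b: "?b = inv\<^bsub>F\<^esub> ?a"
    using a by (simp add: inv_letter_free_group)
  have "inv\<^bsub>F\<^esub> (inv\<^bsub>F\<^esub> rep ?j \<otimes>\<^bsub>F\<^esub> (?a \<otimes>\<^bsub>F\<^esub> rep i)) \<in> H"
    using index(2)[of "?a \<otimes>\<^bsub>F\<^esub> rep i"] car unfolding move_def by (intro H.m_inv_closed) simp
  also have "inv\<^bsub>F\<^esub> (inv\<^bsub>F\<^esub> rep ?j \<otimes>\<^bsub>F\<^esub> (?a \<otimes>\<^bsub>F\<^esub> rep i)) = inv\<^bsub>F\<^esub> rep i \<otimes>\<^bsub>F\<^esub> (?b \<otimes>\<^bsub>F\<^esub> rep ?j)"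
    using car by (simp add: b F.inv_mult_group F.m_assoc)
  finally show ?thesis
    unfolding move_def[of "inv_letter a"] using car i by (intro index_eq) auto
qed

lemma move_rep: "Suc i < p \<Longrightarrow> move (x0, True) i = Suc i"
  by (simp add: move_def index_rep flip: rep_Suc)

lemma basis_iff: "prod_encode (x, m) \<in> basis \<longleftrightarrow> x \<in> X \<and> m < p \<and> \<not> (x = x0 \<and> m < p - 1)"
  by (auto simp: basis_def inj_image_mem_iff[OF inj_prod_encode])

lemma gen_in_H:
  assumes "y \<in> basis"
  shows "gen y \<in> H"
proof -
  obtain x i where y: "prod_decode y = (x, i)"
    by force
  then have "x \<in> X"
    using assms by (auto simp: basis_def)
  then show ?thesis
    using index(2)[of "[(x, True)] \<otimes>\<^bsub>F\<^esub> rep i"] by (simp add: gen_def y move_def letter_in_free_group)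
qed

lemma gen_closed: "y \<in> basis \<Longrightarrow> gen y \<in> carrier F"
  using gen_in_H H.subset by blast

lemma emb_hom: "emb \<in> hom (free_group basis) F"
  by (intro eval_word_hom group_free_group gen_closed)

sublocale emb: group_hom "free_group basis" F emb
  by (simp add: group_hom_def group_hom_axioms_def emb_hom group_free_group)

lemma emb_in_H: "w \<in> carrier (free_group basis) \<Longrightarrow> emb w \<in> H"
  by (rule eval_word_in_subgroup[OF group_free_group H gen_in_H]) (auto simp: carrier_free_group)

lemma emb_letter: "y \<in> basis \<Longrightarrow> emb [(y, True)] = gen y"
  using gen_closed by (simp add: eval_word_def eval_letter_def)

lemma act_closed:
  assumes "fst a \<in> X" "z \<in> states"
  shows "act a z \<in> states"
proof -
  have "cons_letter (y, b) w \<in> carrier (free_group basis)"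
    if "y \<in> basis" "w \<in> carrier (free_group basis)" for y b w
    using emb.G.m_closed[of "[(y, b)]" w] that by (simp add: letter_in_free_group mult_free_group)
  then show ?thesis
    using assms move_closed[OF assms(1)] by (auto simp: act_def states_def Let_def basis_iff)
qed

lemma act_inverse:
  assumes "fst a \<in> X" "z \<in> states"
  shows "act (inv_letter a) (act a z) = z"
proof -
  obtain x b where a: "a = (x, b)"
    by force
  obtain i w where z: "z = (i, w)" "i < p" "reduced w"
    using assms(2) by (auto simp: states_def carrier_free_group)
  have "cons_letter (y, \<not> b) (cons_letter (y, b) w) = w" for y
    using cons_letter_cancel[OF z(3), of "(y, b)"] by simp
  then show ?thesis
    using move_inverse[OF assms(1) z(2)] by (auto simp: act_def a z(1) Let_def)
qed

lemma act_inverse':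
  assumes "fst a \<in> X" "z \<in> states"
  shows "act a (act (inv_letter a) z) = z"
  using act_inverse[of "inv_letter a"] assms by simp

lemma act_word_closed:
  assumes "u \<in> carrier F" "z \<in> states"
  shows "foldr act u z \<in> states"
  using assms by (intro foldr_action_closed[of X, OF act_closed]) (auto simp: carrier_free_group)

lemma act_word_mult:
  assumes "u \<in> carrier F" "v \<in> carrier F" "z \<in> states"
  shows "foldr act (u \<otimes>\<^bsub>F\<^esub> v) z = foldr act u (foldr act v z)"
  unfolding mult_free_group using assms
  by (intro foldr_action_mult[of X states act, OF act_closed act_inverse']) (auto simp: carrier_free_group)

lemma act_word_inv:
  assumes "u \<in> carrier F" "z \<in> states" "foldr act u z = z'"
  shows "foldr act (inv\<^bsub>F\<^esub> u) z' = z"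
  using act_word_mult[of "inv\<^bsub>F\<^esub> u" u z] assms by (simp add: one_free_group)

lemma realize_closed: "z \<in> states \<Longrightarrow> realize z \<in> carrier F"
  by (auto simp: realize_def states_def)

text \<open>
  The action of \<open>F\<close> on pairs is left multiplication on the elements for which they stand.
\<close>

lemma realize_act_pos:
  assumes "x \<in> X" "z \<in> states"
  shows "realize (act (x, True) z) = [(x, True)] \<otimes>\<^bsub>F\<^esub> realize z"
proof -
  obtain i w where z: "z = (i, w)" "i < p" "w \<in> carrier (free_group basis)"
    using assms(2) by (auto simp: states_def)
  let ?x = "[(x, True)]" and ?j = "move (x, True) i" and ?y = "prod_encode (x, i)"
  have x: "?x \<in> carrier F"
    using assms(1) by (simp add: letter_in_free_group)
  show ?thesis
  proof (cases "x = x0 \<and> i < p - 1")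
    case True
    then have "?j = Suc i"
      using move_rep[of i] by auto
    then have "rep ?j = ?x \<otimes>\<^bsub>F\<^esub> rep i"
      using True by (simp add: rep_Suc)
    then show ?thesis
      using True x z by (simp add: act_def realize_def F.m_assoc)
  next
    case False
    then have y: "?y \<in> basis"
      using assms(1) z(2) by (simp add: basis_iff)
    then have "emb (cons_letter (?y, True) w) = gen ?y \<otimes>\<^bsub>F\<^esub> emb w"
      using emb.hom_mult[of "[(?y, True)]" w] z(3) emb_letter
      by (simp add: mult_free_group letter_in_free_group)
    moreover have "rep ?j \<otimes>\<^bsub>F\<^esub> gen ?y = ?x \<otimes>\<^bsub>F\<^esub> rep i"
      using x by (simp add: gen_def flip: F.m_assoc)
    ultimately show ?thesis
      using False x z gen_closed[OF y] by (auto simp: act_def realize_def simp flip: F.m_assoc)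
  qed
qed

lemma realize_act:
  assumes "fst a \<in> X" "z \<in> states"
  shows "realize (act a z) = [a] \<otimes>\<^bsub>F\<^esub> realize z"
proof (cases "snd a")
  case True
  then show ?thesis
    using realize_act_pos[of "fst a" z] assms by (cases a) simp
next
  case False
  then obtain x where a: "a = (x, False)"
    by (cases a) auto
  let ?z = "act a z"
  have z: "?z \<in> states"
    using assms by (rule act_closed)
  have "realize z = [(x, True)] \<otimes>\<^bsub>F\<^esub> realize ?z"
    using realize_act_pos[of x ?z] act_inverse[OF assms] z assms(1) a by simp
  moreover have "[a] = inv\<^bsub>F\<^esub> [(x, True)]"
    using assms(1) by (simp add: a inv_letter_free_group)
  ultimately show ?thesis
    using realize_closed[OF z] assms(1) a
    by (simp add: letter_in_free_group flip: F.m_assoc)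
qed

lemma realize_act_word:
  assumes "u \<in> carrier F" "z \<in> states"
  shows "realize (foldr act u z) = u \<otimes>\<^bsub>F\<^esub> realize z"
  using assms(1)
proof (induction u)
  case Nil
  then show ?case
    using realize_closed[OF assms(2)] F.l_one by (simp add: one_free_group)
next
  case (Cons a u)
  note u = Cons_in_free_group[OF Cons.prems]
  have "realize (foldr act (a # u) z) = [a] \<otimes>\<^bsub>F\<^esub> (u \<otimes>\<^bsub>F\<^esub> realize z)"
    using realize_act[OF u(1) act_word_closed[OF u(2) assms(2)]] Cons.IH[OF u(2)] by simp
  also have "\<dots> = (a # u) \<otimes>\<^bsub>F\<^esub> realize z"
    using u realize_closed[OF assms(2)] F.m_assoc[of "[a]" u "realize z"]
    by (simp add: letter_in_free_group)
  finally show ?case .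
qed

text \<open>
  Climbing the transversal meets only trivial Schreier generators and leaves the word alone. This is
  the Schreier property, on which the freeness of the basis rests.
\<close>

lemma act_rep:
  assumes "i < p" "w \<in> carrier (free_group basis)"
  shows "foldr act (rep i) (0, w) = (i, w)"
  using assms(1)
proof (induction i)
  case 0
  then show ?case
    by (simp add: rep_0)
next
  case (Suc i)
  have "foldr act (rep (Suc i)) (0, w) = act (x0, True) (i, w)"
    unfolding rep_Suc using x0 p assms(2) Suc
    by (subst act_word_mult) (auto simp: letter_in_free_group states_def)
  also have "act (x0, True) (i, w) = (Suc i, w)"
    using Suc.prems by (auto simp: act_def move_rep)
  finally show ?case .
qed

text \<open>
  Read from right to left, \<open>x0^(-j) x x0^i\<close> climbs to coset \<open>i\<close>, moves to coset \<open>j\<close> with the symbol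
  \<open>y\<close> prepended, and climbs down again.
\<close>

lemma act_gen:
  assumes "y \<in> basis" "w \<in> carrier (free_group basis)"
  shows "foldr act (gen y) (0, w) = (0, cons_letter (y, True) w)"
proof -
  obtain x i where y: "y = prod_encode (x, i)" "x \<in> X" "i < p" "\<not> (x = x0 \<and> i < p - 1)"
    using assms(1) by (auto simp: basis_def)
  let ?j = "move (x, True) i" and ?w = "cons_letter (y, True) w"
  have x: "[(x, True)] \<in> carrier F"
    using y(2) by (simp add: letter_in_free_group)
  have zs: "(0, w) \<in> states" "(i, w) \<in> states"
    using assms(2) p y(3) by (auto simp: states_def)
  have "?w \<in> carrier (free_group basis)"
    using emb.G.m_closed[of "[(y, True)]" w] assms by (simp add: letter_in_free_group mult_free_group)
  then have "foldr act (rep ?j) (0, ?w) = (?j, ?w)" and zw: "(0, ?w) \<in> states"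
    using act_rep[of ?j] move_closed[of "(x, True)"] y(2) p by (auto simp: states_def)
  then have j: "foldr act (inv\<^bsub>F\<^esub> rep ?j) (?j, ?w) = (0, ?w)"
    by (intro act_word_inv) auto
  have "foldr act (gen y) (0, w) =
      foldr act (inv\<^bsub>F\<^esub> rep ?j) (foldr act [(x, True)] (foldr act (rep i) (0, w)))"
    using zs x by (simp add: gen_def y(1) act_word_mult act_word_closed del: foldr.simps)
  also have "\<dots> = foldr act (inv\<^bsub>F\<^esub> rep ?j) (?j, ?w)"
    using act_rep[OF y(3) assms(2)] y(1,4) by (auto simp: act_def)
  finally show ?thesis
    using j by simp
qed

lemma act_emb:
  assumes "w \<in> carrier (free_group basis)"
  shows "foldr act (emb w) (0, []) = (0, w)"
  using assms
proof (induction w)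
  case Nil
  then show ?case
    using emb.hom_one by (simp add: one_free_group)
next
  case (Cons a w)
  note w = Cons_in_free_group[OF Cons.prems]
  have start: "(0, []) \<in> states" and zw: "(0, w) \<in> states" and zaw: "(0, a # w) \<in> states"
    using p w(2) Cons.prems emb.G.one_closed by (auto simp: states_def one_free_group)
  have a: "[a] \<in> carrier (free_group basis)"
    using w(1) by (simp add: letter_in_free_group)
  have "emb (a # w) = emb [a] \<otimes>\<^bsub>F\<^esub> emb w"
    using emb.hom_mult[OF a w(2)] w(3) by simp
  then have "foldr act (emb (a # w)) (0, []) = foldr act (emb [a]) (0, w)"
    using act_word_mult[OF _ _ start, of "emb [a]" "emb w"] a w(2) Cons.IH[OF w(2)] by simp
  also have "\<dots> = (0, a # w)"
  proof (cases "snd a")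
    case True
    then have "a = (fst a, True)"
      by (cases a) simp
    then show ?thesis
      using act_gen[OF w(1) w(2)] w(3) emb_letter[OF w(1)] by (simp add: mult_free_group)
  next
    case False
    then have a': "a = (fst a, False)"
      by (cases a) simp
    have "cons_letter (fst a, True) (a # w) = w"
      by (subst a') (simp add: cons_letter_def)
    then have "foldr act (gen (fst a)) (0, a # w) = (0, w)"
      using act_gen[OF w(1) Cons.prems] by simp
    then have "foldr act (inv\<^bsub>F\<^esub> gen (fst a)) (0, w) = (0, a # w)"
      using act_word_inv[OF gen_closed[OF w(1)] zaw] by simp
    moreover have "emb [a] = inv\<^bsub>F\<^esub> gen (fst a)"
      using False gen_closed[OF w(1)] by (simp add: eval_word_def eval_letter_def)
    ultimately show ?thesis
      by simp
  qed
  finally show ?case .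
qed

lemma emb_inj: "inj_on emb (carrier (free_group basis))"
  by (rule inj_onI) (metis act_emb prod.inject)

lemma emb_image: "emb ` carrier (free_group basis) = H"
proof
  show "H \<subseteq> emb ` carrier (free_group basis)"
  proof
    fix u assume u: "u \<in> H"
    then have uF: "u \<in> carrier F"
      using H.subset by blast
    have start: "(0, []) \<in> states"
      using p emb.G.one_closed by (auto simp: states_def one_free_group)
    obtain i w where z: "foldr act u (0, []) = (i, w)" "i < p" "w \<in> carrier (free_group basis)"
      using act_word_closed[OF uF start] by (cases "foldr act u (0, [])") (auto simp: states_def)
    have "realize (0, []) = \<one>\<^bsub>F\<^esub>"
      using emb.hom_one by (simp add: realize_def rep_0 one_free_group mult_free_group)
    then have eq: "rep i \<otimes>\<^bsub>F\<^esub> emb w = u"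
      using realize_act_word[OF uF start] z(1) uF by (simp add: realize_def)
    then have "inv\<^bsub>F\<^esub> rep i \<otimes>\<^bsub>F\<^esub> u = emb w"
      using z(3) by (auto simp flip: F.m_assoc)
    then have "index u = i"
      using uF z emb_in_H by (intro index_eq) auto
    moreover have "index u = 0"
      using uF p u by (intro index_eq) (auto simp: rep_0 simp flip: one_free_group[of X])
    ultimately have "u = emb w"
      using eq z(3) F.l_one by (simp add: rep_0 one_free_group)
    then show "u \<in> emb ` carrier (free_group basis)"
      using z(3) by blast
  qed
qed (use emb_in_H in blast)

text \<open>
  The Schreier index formula \<open>rank H - 1 = p (rank F - 1)\<close>.
\<close>

lemma card_basis:
  assumes "finite X"
  shows "finite basis" "card basis = p * (card X - 1) + 1"
proof -
  show "finite basis"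
    using assms by (simp add: basis_def)
  obtain n where n: "card X = Suc n"
    using assms x0 by (metis card_Suc_Diff1)
  have "card basis = card (X \<times> {..<p} - {x0} \<times> {..<p - 1})"
    unfolding basis_def by (rule card_image) (meson inj_prod_encode inj_on_subset subset_UNIV)
  also have "\<dots> = card X * p - (p - 1)"
    using assms x0 by (subst card_Diff_subset) (auto simp: card_cartesian_product)
  also have "\<dots> = p * (card X - 1) + 1"
    using p n by (simp add: algebra_simps)
  finally show "card basis = p * (card X - 1) + 1" .
qed

end


section \<open>Weights of relators\<close>

lemma p_weight_nonneg: "0 \<le> p_weight X p r"
  by (auto simp: p_weight_def split: enat.split)

lemma p_weight_one: "p_weight X p \<one>\<^bsub>free_group X\<^esub> = 0"
  by (simp add: p_weight_def p_order_def)

text \<open>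
  Exhibiting any root bounds the weight, since a root of larger exponent only lowers it. To bound a
  deficiency from below it is therefore enough to find roots of the relators, maximal or not.
\<close>

lemma p_weight_pow_le:
  assumes "prime p" "s \<in> carrier (free_group X)"
  shows "p_weight X p (s [^]\<^bsub>free_group X\<^esub> (p ^ k)) \<le> 1 / real p ^ k"
proof (cases "s [^]\<^bsub>free_group X\<^esub> (p ^ k) = \<one>\<^bsub>free_group X\<^esub>")
  case True
  then show ?thesis
    by (simp add: p_weight_one)
next
  case False
  interpret F: group "free_group X"
    by (rule group_free_group)
  obtain l where l: "p_order X p (s [^]\<^bsub>free_group X\<^esub> (p ^ k)) = enat l" "k \<le> l"
    using p_order_attained[OF assms(1) F.nat_pow_closed[OF assms(2)] False] assms(2) by metis
  have "1 / real p ^ l \<le> 1 / real p ^ k"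
    using l(2) prime_ge_1_nat[OF assms(1)] prime_gt_0_nat[OF assms(1)]
    by (intro divide_left_mono power_increasing) auto
  then show ?thesis
    using l(1) by (simp add: p_weight_def)
qed

lemma p_weight_attained:
  assumes "prime p" "r \<in> carrier (free_group X)" "r \<noteq> \<one>\<^bsub>free_group X\<^esub>"
  obtains k s where "p_weight X p r = 1 / real p ^ k" "s \<in> carrier (free_group X)"
    "r = s [^]\<^bsub>free_group X\<^esub> (p ^ k)"
  using p_order_attained[OF assms] by (metis enat.simps(4) p_weight_def)

lemma (in group) conj_nat_pow:
  fixes n :: nat
  assumes "t \<in> carrier G" "s \<in> carrier G"
  shows "t \<otimes> (s [^] n) \<otimes> inv t = (t \<otimes> s \<otimes> inv t) [^] n"
proof (induction n)
  case 0
  then show ?case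
    using assms by simp
next
  case (Suc n)
  have cancel: "inv t \<otimes> (t \<otimes> x) = x" if "x \<in> carrier G" for x
    using that assms by (simp flip: m_assoc)
  have "t \<otimes> (s [^] Suc n) \<otimes> inv t = (t \<otimes> (s [^] n) \<otimes> inv t) \<otimes> (t \<otimes> s \<otimes> inv t)"
    using assms by (simp add: m_assoc cancel)
  then show ?case
    using Suc by simp
qed

lemma (in normal) pow_index_in:
  assumes "g \<in> carrier G"
  shows "g [^] card (rcosets H) \<in> H"
proof -
  interpret Q: group "G Mod H"
    by (rule factorgroup_is_group)
  have a: "H #> g \<in> carrier (G Mod H)"
    using assms by (auto simp: FactGroup_def RCOSETS_def)
  have "H #> (g [^] card (rcosets H)) = (H #> g) [^]\<^bsub>G Mod H\<^esub> order (G Mod H)"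
    using FactGroup_pow[OF assms] by (simp add: order_def FactGroup_def)
  also have "\<dots> = H"
    using Q.pow_order_eq_1[OF a] by (simp add: FactGroup_def)
  finally show ?thesis
    using coset_join1[OF _ _ subgroup_axioms] assms by blast
qed

text \<open>
  The heart of the argument. Write \<open>r = s^(p^k)\<close> with \<open>k\<close> maximal.

  If \<open>s \<in> H\<close>, then the \<open>p\<close> conjugates of \<open>r\<close> by powers of some \<open>g0 \<notin> H\<close> represent all the classes. Each
  is the \<open>p^k\<close>-th power of a conjugate of \<open>s\<close>, which lies in the normal subgroup \<open>H\<close>, so the total
  weight is at most \<open>p / p^k\<close>.

  If \<open>s \<notin> H\<close>, then the powers of \<open>s\<close> themselves represent the cosets of \<open>H\<close>. They commute with \<open>r\<close>,
  so \<open>r\<close> alone suffices. Its root has shrunk from \<open>s\<close> to \<open>s^p \<in> H\<close>, so the weight has grown from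
  \<open>1 / p^k\<close> to at most \<open>1 / p^(k-1)\<close>, again a factor \<open>p\<close>.
\<close>

lemma relator_conjugates:
  assumes p: "prime p" and N: "H \<lhd> free_group X" and index: "card (rcosets\<^bsub>free_group X\<^esub> H) = p"
    and emb: "emb \<in> hom (free_group Y) (free_group X)"
    and image: "emb ` carrier (free_group Y) = H" and r: "r \<in> H" and g0: "g0 \<in> carrier (free_group X)" "g0 \<notin> H"
  obtains C where "finite C" "conjugate_system (free_group X) (free_group Y) emb r C"
    "sum (p_weight Y p) C \<le> real p * p_weight X p r"
proof -
  interpret F: group "free_group X"
    by (rule group_free_group)
  interpret G: group "free_group Y"
    by (rule group_free_group)
  interpret emb: group_hom "free_group Y" "free_group X" emb
    using emb by (simp add: group_hom_def group_hom_axioms_def F.is_group G.is_group)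
  interpret N: normal H "free_group X"
    by (rule N)
  let ?F = "free_group X" and ?G = "free_group Y"
  have rF: "r \<in> carrier ?F"
    using r N.subset by blast
  have p0: "0 < p"
    using p by (rule prime_gt_0_nat)
  define pre where "pre = inv_into (carrier ?G) emb"
  have pre: "pre u \<in> carrier ?G" "emb (pre u) = u" if "u \<in> H" for u
    using that image unfolding pre_def by (auto intro: inv_into_into f_inv_into_f)
  \<comment> \<open>If \<open>g\<close> lies in the coset of \<open>t^i\<close>, then conjugating by \<open>g\<close> is conjugating by \<open>t^i\<close> followed by
    conjugating by \<open>g t^(-i) \<in> H\<close>, so the conjugates by the powers of \<open>t\<close> represent every class.\<close>
  have system: "conjugate_system ?F ?G emb r C"
    if C: "C \<subseteq> carrier ?G" and t: "t \<in> carrier ?F" "t \<notin> H"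
      and CF: "\<And>c. c \<in> C \<Longrightarrow> \<exists>g\<in>carrier ?F. emb c = g \<otimes>\<^bsub>?F\<^esub> r \<otimes>\<^bsub>?F\<^esub> inv\<^bsub>?F\<^esub> g"
      and tC: "\<And>i. i < p \<Longrightarrow> \<exists>c\<in>C. emb c = (t [^]\<^bsub>?F\<^esub> i) \<otimes>\<^bsub>?F\<^esub> r \<otimes>\<^bsub>?F\<^esub> inv\<^bsub>?F\<^esub> (t [^]\<^bsub>?F\<^esub> i)"
    for C t
    unfolding conjugate_system_def
  proof (intro conjI ballI)
    fix g assume g: "g \<in> carrier ?F"
    obtain i where i: "i < p" "inv\<^bsub>?F\<^esub> (t [^]\<^bsub>?F\<^esub> i) \<otimes>\<^bsub>?F\<^esub> g \<in> H"
      using F.prime_index_transversal[OF N p index t g] by blast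
    let ?t = "t [^]\<^bsub>?F\<^esub> i"
    have tF: "?t \<in> carrier ?F"
      using t by simp
    have "?t \<otimes>\<^bsub>?F\<^esub> (inv\<^bsub>?F\<^esub> ?t \<otimes>\<^bsub>?F\<^esub> g) \<otimes>\<^bsub>?F\<^esub> inv\<^bsub>?F\<^esub> ?t \<in> H"
      by (rule N.inv_op_closed2[OF tF i(2)])
    then have h: "g \<otimes>\<^bsub>?F\<^esub> inv\<^bsub>?F\<^esub> ?t \<in> H"
      using tF g by (simp flip: F.m_assoc)
    obtain c where c: "c \<in> C" "emb c = ?t \<otimes>\<^bsub>?F\<^esub> r \<otimes>\<^bsub>?F\<^esub> inv\<^bsub>?F\<^esub> ?t"
      using tC[OF i(1)] by blast
    let ?h = "pre (g \<otimes>\<^bsub>?F\<^esub> inv\<^bsub>?F\<^esub> ?t)"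
    have "emb (?h \<otimes>\<^bsub>?G\<^esub> c \<otimes>\<^bsub>?G\<^esub> inv\<^bsub>?G\<^esub> ?h) =
        (g \<otimes>\<^bsub>?F\<^esub> inv\<^bsub>?F\<^esub> ?t) \<otimes>\<^bsub>?F\<^esub> (?t \<otimes>\<^bsub>?F\<^esub> r \<otimes>\<^bsub>?F\<^esub> inv\<^bsub>?F\<^esub> ?t) \<otimes>\<^bsub>?F\<^esub> inv\<^bsub>?F\<^esub> (g \<otimes>\<^bsub>?F\<^esub> inv\<^bsub>?F\<^esub> ?t)"
      using pre[OF h] c C by (auto simp: subset_iff)
    also have "\<dots> = g \<otimes>\<^bsub>?F\<^esub> r \<otimes>\<^bsub>?F\<^esub> inv\<^bsub>?F\<^esub> g"
    proof -
      have "inv\<^bsub>?F\<^esub> ?t \<otimes>\<^bsub>?F\<^esub> (?t \<otimes>\<^bsub>?F\<^esub> x) = x" if "x \<in> carrier ?F" for x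
        using that tF by (simp flip: F.m_assoc)
      then show ?thesis
        using tF g rF by (simp add: F.m_assoc F.inv_mult_group)
    qed
    finally show "\<exists>h\<in>carrier ?G. \<exists>c\<in>C. g \<otimes>\<^bsub>?F\<^esub> r \<otimes>\<^bsub>?F\<^esub> inv\<^bsub>?F\<^esub> g =
        emb (h \<otimes>\<^bsub>?G\<^esub> c \<otimes>\<^bsub>?G\<^esub> inv\<^bsub>?G\<^esub> h)"
      using pre(1)[OF h] c(1) by metis
  qed (use C CF in auto)
  show thesis
  proof (cases "r = \<one>\<^bsub>?F\<^esub>")
    case True
    \<comment> \<open>The trivial relator has no maximal root, but it is its only conjugate and has weight \<open>0\<close>.\<close>
    show thesis
    proof (rule that[of "{\<one>\<^bsub>?G\<^esub>}"])
      show "conjugate_system ?F ?G emb r {\<one>\<^bsub>?G\<^esub>}"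
        using True g0 by (intro system[OF _ g0]) (auto intro!: bexI[of _ "\<one>\<^bsub>?F\<^esub>"])
    qed (auto simp: p_weight_one p_weight_nonneg)
  next
    case False
    obtain k s where weight: "p_weight X p r = 1 / real p ^ k" and s: "s \<in> carrier ?F"
      and rs: "r = s [^]\<^bsub>?F\<^esub> (p ^ k)"
      using p_weight_attained[OF p rF False] .
    show thesis
    proof (cases "s \<in> H")
      case True
      define root where "root i = pre ((g0 [^]\<^bsub>?F\<^esub> i) \<otimes>\<^bsub>?F\<^esub> s \<otimes>\<^bsub>?F\<^esub> inv\<^bsub>?F\<^esub> (g0 [^]\<^bsub>?F\<^esub> i))" for i :: nat
      define c where "c i = root i [^]\<^bsub>?G\<^esub> (p ^ k)" for i
      have root: "root i \<in> carrier ?G"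
        "emb (root i) = (g0 [^]\<^bsub>?F\<^esub> i) \<otimes>\<^bsub>?F\<^esub> s \<otimes>\<^bsub>?F\<^esub> inv\<^bsub>?F\<^esub> (g0 [^]\<^bsub>?F\<^esub> i)" for i
        using pre[of "(g0 [^]\<^bsub>?F\<^esub> i) \<otimes>\<^bsub>?F\<^esub> s \<otimes>\<^bsub>?F\<^esub> inv\<^bsub>?F\<^esub> (g0 [^]\<^bsub>?F\<^esub> i)"] True g0(1)
          N.inv_op_closed2[of "g0 [^]\<^bsub>?F\<^esub> i" s] unfolding root_def by auto
      have emb_c: "emb (c i) = (g0 [^]\<^bsub>?F\<^esub> i) \<otimes>\<^bsub>?F\<^esub> r \<otimes>\<^bsub>?F\<^esub> inv\<^bsub>?F\<^esub> (g0 [^]\<^bsub>?F\<^esub> i)" for i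
        unfolding c_def rs using root[of i] s g0(1) by (simp add: emb.hom_nat_pow F.conj_nat_pow)
      have sub: "c ` {..<p} \<subseteq> carrier ?G"
        using root(1) by (auto simp: c_def)
      have "sum (p_weight Y p) (c ` {..<p}) \<le> (\<Sum>i<p. p_weight Y p (c i))"
        using sum_image_le[of "{..<p}" "p_weight Y p" c] by (simp add: p_weight_nonneg comp_def)
      also have "\<dots> \<le> (\<Sum>i<p. p_weight X p r)"
        unfolding weight c_def by (intro sum_mono p_weight_pow_le[OF p root(1)])
      finally have sum: "sum (p_weight Y p) (c ` {..<p}) \<le> real p * p_weight X p r"
        by simp
      show thesis
      proof (rule that[OF _ _ sum])
        show "conjugate_system ?F ?G emb r (c ` {..<p})"
          using emb_c g0(1) by (intro system[OF sub g0]) auto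
      qed simp
    next
      case s_notin: False
      \<comment> \<open>For \<open>k = 0\<close> the root \<open>s\<close> would be the relator \<open>r \<in> H\<close> itself.\<close>
      have "k \<noteq> 0"
        using s_notin r rs s by (metis F.nat_pow_eone power_0)
      then obtain l where k: "k = Suc l"
        by (cases k) auto
      have sp: "s [^]\<^bsub>?F\<^esub> p \<in> H"
        using N.pow_index_in[OF s] index by simp
      define c where "c = pre (s [^]\<^bsub>?F\<^esub> p) [^]\<^bsub>?G\<^esub> (p ^ l)"
      have cG: "{c} \<subseteq> carrier ?G"
        using pre[OF sp] by (simp add: c_def)
      have emb_c: "emb c = r"
        using pre[OF sp] s by (simp add: c_def rs k emb.hom_nat_pow F.nat_pow_pow)
      have commute: "(s [^]\<^bsub>?F\<^esub> i) \<otimes>\<^bsub>?F\<^esub> r \<otimes>\<^bsub>?F\<^esub> inv\<^bsub>?F\<^esub> (s [^]\<^bsub>?F\<^esub> i) = r" for i :: nat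
      proof -
        have "(s [^]\<^bsub>?F\<^esub> i) \<otimes>\<^bsub>?F\<^esub> r = r \<otimes>\<^bsub>?F\<^esub> (s [^]\<^bsub>?F\<^esub> i)"
          using s by (simp add: rs F.nat_pow_mult add.commute)
        then show ?thesis
          using s rF by (simp add: F.m_assoc)
      qed
      have "p_weight Y p c \<le> 1 / real p ^ l"
        unfolding c_def by (rule p_weight_pow_le[OF p pre(1)[OF sp]])
      also have "\<dots> = real p * p_weight X p r"
        using p0 by (simp add: weight k)
      finally have "sum (p_weight Y p) {c} \<le> real p * p_weight X p r"
        by simp
      then show thesis
        using emb_c rF commute
        by (intro that[of "{c}"] system[OF cG s s_notin]) (auto intro!: bexI[of _ "\<one>\<^bsub>?F\<^esub>"])
    qed
  qed
qed

text \<open>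
  The sets \<open>C i\<close> may overlap, and merging equal relators only decreases the sum.
\<close>

lemma infsum_UNION_le:
  fixes f :: "'b \<Rightarrow> real" and g :: "'a \<Rightarrow> real"
  assumes f: "\<And>x. 0 \<le> f x" and g: "g summable_on I" "\<And>i. i \<in> I \<Longrightarrow> 0 \<le> g i"
    and C: "\<And>i. i \<in> I \<Longrightarrow> finite (C i)" "\<And>i. i \<in> I \<Longrightarrow> sum f (C i) \<le> g i"
  shows "f summable_on (\<Union>i\<in>I. C i)" "infsum f (\<Union>i\<in>I. C i) \<le> infsum g I"
proof -
  have bound: "sum f A \<le> infsum g I" if "finite A" "A \<subseteq> (\<Union>i\<in>I. C i)" for A
  proof -
    have "\<forall>a\<in>A. \<exists>i. i \<in> I \<and> a \<in> C i"
      using that(2) by blast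
    then obtain h where h: "\<And>a. a \<in> A \<Longrightarrow> h a \<in> I \<and> a \<in> C (h a)"
      by metis
    define J where "J = h ` A"
    have J: "J \<subseteq> I" "finite J" "A \<subseteq> (\<Union>i\<in>J. C i)"
      using h that(1) by (auto simp: J_def)
    have fin: "finite (Sigma J C)"
      using J C(1) by auto
    have "sum f A \<le> sum f (snd ` Sigma J C)"
      using J fin f by (intro sum_mono2) (force simp: image_iff)+
    also have "\<dots> \<le> sum (f \<circ> snd) (Sigma J C)"
      by (intro sum_image_le fin f)
    also have "\<dots> = (\<Sum>i\<in>J. sum f (C i))"
      using J C(1) by (subst sum.Sigma) (auto simp: case_prod_beta comp_def)
    also have "\<dots> \<le> sum g J"
      using J C(2) by (intro sum_mono) auto
    also have "\<dots> \<le> infsum g I"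
      using J g by (intro finite_sum_le_infsum) auto
    finally show ?thesis .
  qed
  show sm: "f summable_on (\<Union>i\<in>I. C i)"
    by (rule nonneg_bdd_above_summable_on) (use f bound in \<open>auto intro!: bdd_aboveI\<close>)
  show "infsum f (\<Union>i\<in>I. C i) \<le> infsum g I"
    by (rule infsum_le_finite_sums[OF sm bound])
qed

section \<open>Presentations of subgroups of index \<open>p\<close>\<close>

text \<open>
  Both quotients are isomorphic, by the homomorphism that \<open>f\<close> induces.
\<close>

lemma vimage_normal_index:
  assumes f: "group_hom F G f" "f ` carrier F = carrier G" and N: "N \<lhd> G"
  defines "H \<equiv> {u \<in> carrier F. f u \<in> N}"
  shows "H \<lhd> F" "card (rcosets\<^bsub>F\<^esub> H) = card (rcosets\<^bsub>G\<^esub> N)"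
proof -
  interpret f: group_hom F G f by fact
  interpret N: normal N G by fact
  interpret Q: group "G Mod N" by (rule N.factorgroup_is_group)
  let ?q = "(\<lambda>a. N #>\<^bsub>G\<^esub> a) \<circ> f"
  have "?q \<in> hom F (G Mod N)"
    using f.homh N.r_coset_hom_Mod by (rule Group.hom_compose)
  then interpret q: group_hom F "G Mod N" ?q
    by (simp add: group_hom_def group_hom_axioms_def f.G.is_group Q.is_group)
  have coset: "N #>\<^bsub>G\<^esub> a = N \<longleftrightarrow> a \<in> N" if "a \<in> carrier G" for a
    using f.H.coset_join1[OF _ that N.subgroup_axioms] f.H.coset_join2[OF that N.subgroup_axioms] by blast
  have ker: "kernel F (G Mod N) ?q = H"
    unfolding kernel_def H_def by (rule Collect_cong) (metis coset f.hom_closed comp_apply one_FactGroup)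
  then show "H \<lhd> F"
    using q.normal_kernel by simp
  have "carrier (G Mod N) = (\<lambda>a. N #>\<^bsub>G\<^esub> a) ` carrier G"
    by (auto simp: FactGroup_def RCOSETS_def)
  then have "?q ` carrier F = carrier (G Mod N)"
    unfolding image_comp[symmetric] f(2) by simp
  then have "F Mod H \<cong> G Mod N"
    using q.FactGroup_iso ker by simp
  then show "card (rcosets\<^bsub>F\<^esub> H) = card (rcosets\<^bsub>G\<^esub> N)"
    using iso_same_card by (fastforce simp: FactGroup_def)
qed

text \<open>
  Passing to the preimage \<open>H\<close> of the subgroup in the free group multiplies the number of generators
  minus one by \<open>p\<close>, and passing from the relators to representatives of their classes in \<open>H\<close>
  multiplies their total weight by at most \<open>p\<close>. The deficiency is the difference of the two.
\<close>

lemma presentation_of_prime_index_subgroup: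
  fixes X :: "nat set" and G :: "('g, 'm) monoid_scheme"
  assumes p: "prime p" and G: "group G" and D: "D \<lhd> G" "card (rcosets\<^bsub>G\<^esub> D) = p"
    and X: "finite X" and R: "presents X R G"
  obtains Y :: "nat set" and S where "finite Y" "presents Y S (G\<lparr>carrier := D\<rparr>)"
    "ereal (real p) * presentation_p_deficiency p X R \<le> presentation_p_deficiency p Y S"
proof -
  interpret G: group G by fact
  interpret F: group "free_group X" by (rule group_free_group)
  interpret D: normal D G by fact
  let ?F = "free_group X" and ?D = "G\<lparr>carrier := D\<rparr>"
  have RF: "R \<subseteq> carrier ?F"
    using R by (simp add: presents_def)
  obtain f where f: "f \<in> hom ?F G" and surj: "f ` carrier ?F = carrier G"
    and ker: "kernel ?F G f = normal_closure ?F R"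
    using R presents_iff_hom[OF G] by blast
  interpret f: group_hom ?F G f
    using f by (simp add: group_hom_def group_hom_axioms_def F.is_group G.is_group)
  define H where "H = {u \<in> carrier ?F. f u \<in> D}"
  have HN: "H \<lhd> ?F" and Hp: "card (rcosets\<^bsub>?F\<^esub> H) = p"
    using vimage_normal_index[OF f.group_hom_axioms surj D(1)] D(2) by (simp_all add: H_def)
  have R_H: "R \<subseteq> H"
  proof
    fix r assume "r \<in> R"
    then have "r \<in> kernel ?F G f"
      unfolding ker by (rule subsetD[OF normal_closure_superset])
    then have "r \<in> carrier ?F" "f r = \<one>\<^bsub>G\<^esub>"
      unfolding kernel_def by blast+
    then show "r \<in> H"
      unfolding H_def using D.one_closed by simp
  qed
  interpret H: normal H ?F by (rule HN)
  \<comment> \<open>A proper subgroup misses some generator, whose powers then represent the cosets.\<close>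
  obtain x0 where x0: "x0 \<in> X" "[(x0, True)] \<notin> H"
  proof (rule ccontr)
    assume "\<not> thesis"
    then have "H = carrier ?F"
      using that free_group_subgroup_eq[OF H.subgroup_axioms] by blast
    then have "rcosets\<^bsub>?F\<^esub> H = {H}"
      using F.coset_join2[OF _ H.subgroup_axioms] F.one_closed by (auto simp: RCOSETS_def)
    then show False
      using Hp prime_gt_1_nat[OF p] by simp
  qed
  have g0: "[(x0, True)] \<in> carrier ?F"
    using x0(1) by (simp add: letter_in_free_group)
  interpret T: cyclic_transversal X H x0 p
    by (rule cyclic_transversal.intro[OF H.subgroup_axioms x0(1) prime_gt_0_nat[OF p]
      F.prime_index_transversal[OF HN p Hp g0 x0(2)]])
  let ?Y = T.basis and ?emb = T.emb
  have "\<exists>C. finite C \<and> conjugate_system ?F (free_group ?Y) ?emb r C \<and>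
      sum (p_weight ?Y p) C \<le> real p * p_weight X p r" if "r \<in> R" for r
    using relator_conjugates[OF p HN Hp T.emb_hom T.emb_image subsetD[OF R_H that] g0 x0(2)] by blast
  then obtain C where C: "\<And>r. r \<in> R \<Longrightarrow> finite (C r)"
    "\<And>r. r \<in> R \<Longrightarrow> conjugate_system ?F (free_group ?Y) ?emb r (C r)"
    "\<And>r. r \<in> R \<Longrightarrow> sum (p_weight ?Y p) (C r) \<le> real p * p_weight X p r"
    by metis
  let ?S = "\<Union>r\<in>R. C r"
  have S: "?S \<subseteq> carrier (free_group ?Y)"
    by (intro UN_least conjugate_system_subset[OF C(2)])
  have closure: "normal_closure (free_group ?Y) ?S =
      {w \<in> carrier (free_group ?Y). ?emb w \<in> normal_closure ?F R}"
    by (rule normal_closure_conjugate_systems[OF group_free_group group_free_group T.emb_hom T.emb_inj RF C(2)])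
  have fH: "f ` H = D"
  proof
    show "D \<subseteq> f ` H"
    proof
      fix d assume d: "d \<in> D"
      then have "d \<in> f ` carrier ?F"
        unfolding surj by (rule subsetD[OF D.subset])
      then show "d \<in> f ` H"
        using d unfolding H_def by blast
    qed
  qed (unfold H_def, blast)
  have emb_D: "f (?emb w) \<in> D" if "w \<in> carrier (free_group ?Y)" for w
    using T.emb_in_H[OF that] fH by blast
  have groupD: "group ?D"
    by (rule D.subgroup_is_group[OF G])
  have "presents ?Y ?S ?D"
    unfolding presents_iff_hom[OF groupD]
  proof (intro conjI bexI[of _ "f \<circ> ?emb"])
    show "(f \<circ> ?emb) ` carrier (free_group ?Y) = carrier ?D"
      unfolding image_comp[symmetric] T.emb_image fH by simp
    show "f \<circ> ?emb \<in> hom (free_group ?Y) ?D"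
      by (rule homI) (simp_all add: emb_D f.hom_mult)
    have "kernel (free_group ?Y) ?D (f \<circ> ?emb) = {w \<in> carrier (free_group ?Y). ?emb w \<in> kernel ?F G f}"
      by (auto simp: kernel_def)
    then show "kernel (free_group ?Y) ?D (f \<circ> ?emb) = normal_closure (free_group ?Y) ?S"
      using closure ker by simp
  qed (rule S)
  moreover have "ereal (real p) * presentation_p_deficiency p X R \<le> presentation_p_deficiency p ?Y ?S"
  proof (cases "p_weight X p summable_on R")
    case True
    note sums = infsum_UNION_le[of "p_weight ?Y p" "\<lambda>r. real p * p_weight X p r" R C,
        OF p_weight_nonneg summable_on_cmult_right[OF True] _ C(1,3)]
    have "card X \<ge> 1"
      using X x0(1) by (metis One_nat_def Suc_leI card_gt_0_iff empty_iff)
    then have "real (card ?Y) = real p * (real (card X) - 1) + 1"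
      using T.card_basis(2)[OF X] by simp
    moreover have "infsum (p_weight ?Y p) ?S \<le> real p * infsum (p_weight X p) R"
      using sums(2) by (simp add: p_weight_nonneg infsum_cmult_right')
    moreover have "p_weight ?Y p summable_on ?S"
      using sums(1) by (simp add: p_weight_nonneg)
    ultimately show ?thesis
      using True by (simp add: presentation_p_deficiency_def algebra_simps)
  next
    case False
    then show ?thesis
      using prime_gt_0_nat[OF p] by (simp add: presentation_p_deficiency_def)
  qed
  ultimately show thesis
    using that[of ?Y ?S] T.card_basis(1)[OF X] by blast
qed

theorem theorem2:
  fixes p :: nat and \<Gamma> :: "('g, 'm) monoid_scheme" and \<Delta> :: "'g set"
  assumes "prime p"
    and "group \<Gamma>"
    and "infinite (carrier \<Gamma>)"
    and "finitely_generated \<Gamma>"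
    and "\<Delta> \<lhd> \<Gamma>"
    and "card (rcosets\<^bsub>\<Gamma>\<^esub> \<Delta>) = p"
  shows "p_deficiency p (\<Gamma>\<lparr>carrier := \<Delta>\<rparr>) \<ge> ereal (real p) * p_deficiency p \<Gamma>"
proof -
  let ?d = "p_deficiency p (\<Gamma>\<lparr>carrier := \<Delta>\<rparr>)"
  have p: "ereal (real p) > 0"
    using prime_gt_0_nat[OF assms(1)] by simp
  have "presentation_p_deficiency p X R \<le> ?d / ereal (real p)"
    if X: "finite X" "presents X R \<Gamma>" for X :: "nat set" and R
  proof -
    obtain Y :: "nat set" and S where Y: "finite Y" "presents Y S (\<Gamma>\<lparr>carrier := \<Delta>\<rparr>)"
      "ereal (real p) * presentation_p_deficiency p X R \<le> presentation_p_deficiency p Y S"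
      using presentation_of_prime_index_subgroup[OF assms(1,2,5,6) X] by blast
    have "presentation_p_deficiency p Y S \<le> ?d"
      unfolding p_deficiency_def by (rule Sup_upper) (use Y in blast)
    then show ?thesis
      using Y(3) p by (simp add: ereal_le_divide_pos)
  qed
  then have "p_deficiency p \<Gamma> \<le> ?d / ereal (real p)"
    unfolding p_deficiency_def[of p \<Gamma>] by (intro Sup_least) blast
  then show ?thesis
    using p by (simp add: ereal_le_divide_pos)
qed


end
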